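(* Let $n\in\mathbb{N}$ and $d\ge 3$, and let $A$ be a nearly orthogonal array $NOA(n,d)$. For each row index $\ell\in[n^2]$, define $$r_\ell = |\{s\neq \ell : A(s,1)=A(\ell,1) \text{ and } A(s,3)=A(\ell,3)\}|,$$ $$c_\ell = |\{s\neq \ell : A(s,2)=A(\ell,2) \text{ and } A(s,3)=A(\ell,3)\}|,$$ where $s$ ranges over $[n^2]$. Then the logarithm of the number of ways to extend $A$ to a nearly orthogonal array with $d+1$ columns (that is, of the number of column vectors $x\in[n]^{n^2}$ such that appending $x$ to $A$ as a $(d+1)$st column gives an $NOA(n,d+1)$) is at most $$\sum_{\ell=1}^{n^2}\int_0^1\log\bigl(1+(r_\ell+c_\ell)t^{d-1}+(n-r_\ell-c_\ell-1)t^{d}\bigr)\,dt.$$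
   Context: Write $[n]=\{1,\dots,n\}$. Two vectors $x,y\in[n]^{n^2}$ are orthogonal if for all $(s,t)\in[n]^2$ there exists a unique index $\ell$ such that $x_\ell=s$ and $y_\ell=t$. Let $v_1=[1,\dots,1,2,\dots,2,\dots,n,\dots,n]^T$ (each symbol repeated $n$ times consecutively) and $v_2=[1,2,\dots,n,1,2,\dots,n,\dots,1,2,\dots,n]^T$ (the block $1,2,\dots,n$ repeated $n$ times), both in $[n]^{n^2}$. For $n\in\mathbb{N}$ and $d\ge3$, a nearly orthogonal array $NOA(n,d)$ is an $n^2\times d$ array $A$ with entries in $[n]$ such that: (a) the first column is $v_1$ and the second column is $v_2$; (b) each symbol in $[n]$ appears exactly $n$ times in the third column $v_3$; (c) for all $i\ge4$, the $i$th column is orthogonal to all other columns of $A$. All logarithms are natural; if the number of extensions is $0$, the statement is vacuous ($\log 0=-\infty$). *)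

theory Defs
  imports "HOL-Analysis.Analysis" "HOL-Library.FuncSet"
begin

text \<open>
  Indices and symbols are 1-based. A column in \<open>[n]^(n^2)\<close> is a function on
  \<open>{1..n\<^sup>2}\<close>; an array \<open>A\<close> has its entry in row \<open>l\<close> and column \<open>i\<close> at \<open>A l i\<close>.
  Values outside the index ranges are irrelevant, except that columns being counted are taken
  extensional (\<open>\<rightarrow>\<^sub>E\<close>), so that each column is counted exactly once.
\<close>

definition orthogonal_columns :: "nat \<Rightarrow> (nat \<Rightarrow> nat) \<Rightarrow> (nat \<Rightarrow> nat) \<Rightarrow> bool" where
  "orthogonal_columns n x y \<longleftrightarrow>
     (\<forall>s\<in>{1..n}. \<forall>t\<in>{1..n}. \<exists>!l. l \<in> {1..n\<^sup>2} \<and> x l = s \<and> y l = t)"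

text \<open>\<open>v1 = (1,...,1,2,...,2,...,n,...,n)\<close> and \<open>v2 = (1,2,...,n,1,2,...,n,...)\<close>.\<close>

definition v1 :: "nat \<Rightarrow> nat \<Rightarrow> nat" where
  "v1 n l = (l - 1) div n + 1"

definition v2 :: "nat \<Rightarrow> nat \<Rightarrow> nat" where
  "v2 n l = (l - 1) mod n + 1"

definition is_NOA :: "nat \<Rightarrow> nat \<Rightarrow> (nat \<Rightarrow> nat \<Rightarrow> nat) \<Rightarrow> bool" where
  "is_NOA n d A \<longleftrightarrow>
     3 \<le> d \<and>
     (\<forall>l\<in>{1..n\<^sup>2}. \<forall>i\<in>{1..d}. A l i \<in> {1..n}) \<and>
     (\<forall>l\<in>{1..n\<^sup>2}. A l 1 = v1 n l \<and> A l 2 = v2 n l) \<and>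
     (\<forall>k\<in>{1..n}. card {l \<in> {1..n\<^sup>2}. A l 3 = k} = n) \<and>
     (\<forall>i\<in>{4..d}. \<forall>j\<in>{1..d}. j \<noteq> i \<longrightarrow>
        orthogonal_columns n (\<lambda>l. A l i) (\<lambda>l. A l j))"

definition append_column ::
    "nat \<Rightarrow> (nat \<Rightarrow> nat \<Rightarrow> nat) \<Rightarrow> (nat \<Rightarrow> nat) \<Rightarrow> nat \<Rightarrow> nat \<Rightarrow> nat" where
  "append_column d A x = (\<lambda>l i. if i = d + 1 then x l else A l i)"

definition NOA_extensions :: "nat \<Rightarrow> nat \<Rightarrow> (nat \<Rightarrow> nat \<Rightarrow> nat) \<Rightarrow> (nat \<Rightarrow> nat) set" where
  "NOA_extensions n d A =
     {x \<in> {1..n\<^sup>2} \<rightarrow>\<^sub>E {1..n}. is_NOA n (d + 1) (append_column d A x)}"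

definition r_count :: "nat \<Rightarrow> (nat \<Rightarrow> nat \<Rightarrow> nat) \<Rightarrow> nat \<Rightarrow> nat" where
  "r_count n A l = card {s \<in> {1..n\<^sup>2}. s \<noteq> l \<and> A s 1 = A l 1 \<and> A s 3 = A l 3}"

definition c_count :: "nat \<Rightarrow> (nat \<Rightarrow> nat \<Rightarrow> nat) \<Rightarrow> nat \<Rightarrow> nat" where
  "c_count n A l = card {s \<in> {1..n\<^sup>2}. s \<noteq> l \<and> A s 2 = A l 2 \<and> A s 3 = A l 3}"

end

theory Submission
  imports Defs
begin

text \<open>
  A discretised form of the entropy method. Give every row \<open>l\<close> a weight \<open>w l \<in> {1..M}\<close> and reveal
  the entries of an extension \<open>x\<close> in order of decreasing weight. Sampling each entry uniformly among
  the values still possible gives \<open>x\<close> probability at least \<open>\<Prod>\<^sub>l 1 / N l\<close>, where \<open>N l\<close> is the number of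
  values possible at \<open>l\<close> given the rows of strictly larger weight; hence \<open>ln\<close> of the number of
  extensions is at most the average over \<open>x\<close> of \<open>\<Sum>\<^sub>l ln (N l)\<close>.

  Now average over all \<open>w\<close>. A symbol \<open>k \<noteq> x l\<close> can remain possible at \<open>l\<close> only if none of the rows
  \<open>s\<close> with \<open>x s = k\<close> that share an entry with row \<open>l\<close> has larger weight. There are \<open>d\<close> such rows, one
  for each column, except that the rows of columns 1 and 3, or of columns 2 and 3, coincide for
  exactly \<open>r\<^sub>l + c\<^sub>l\<close> symbols. Jensen's inequality conditioned on \<open>w l = t\<close> then bounds the average of
  \<open>ln (N l)\<close> by a Riemann sum of the integral, and \<open>M \<rightarrow> \<infinity>\<close> gives the theorem.
\<close>

section \<open>Counting by sequential revelation\<close>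

text \<open>The strict inequality leaves rows of weight equal to \<open>w i\<close> unrevealed, so
  \<open>w\<close> may have ties and can later range over a full product set of independent
  weights.\<close>

definition possible_values ::
    "'i set \<Rightarrow> ('i \<Rightarrow> 'w::linorder) \<Rightarrow> ('i \<Rightarrow> 'v) set \<Rightarrow> ('i \<Rightarrow> 'v) \<Rightarrow> 'i \<Rightarrow> 'v set" where
  "possible_values I w S x i = (\<lambda>y. y i) ` {y \<in> S. \<forall>j\<in>I. w i < w j \<longrightarrow> y j = x j}"

lemma finite_possible_values: "finite S \<Longrightarrow> finite (possible_values I w S x i)"
  by (simp add: possible_values_def)

lemma card_possible_values_pos:
  assumes "finite S" "x \<in> S"
  shows "0 < card (possible_values I w S x i)"
  using assms by (auto simp: card_gt_0_iff finite_possible_values) (auto simp: possible_values_def)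

text \<open>The induction adds the row of largest weight, the one revealed first. Splitting
  \<open>S\<close> by its value there, each fibre contributes at most \<open>1 / card V\<close> by
  the induction hypothesis, which is why \<open>S\<close> is generalised.\<close>

lemma sum_prod_possible_values_le_1:
  fixes w :: "'i \<Rightarrow> 'w::linorder"
  assumes "finite I" "finite S"
    and "\<And>x y. \<lbrakk>x \<in> S; y \<in> S; \<forall>i\<in>I. x i = y i\<rbrakk> \<Longrightarrow> x = y"
  shows "(\<Sum>x\<in>S. \<Prod>i\<in>I. 1 / real (card (possible_values I w S x i))) \<le> 1"
  using assms
proof (induction I arbitrary: S rule: finite_ranking_induct[where f = w])
  case empty
  then have "card S \<le> 1"
    by (simp add: card_le_Suc0_iff_eq)
  then show ?case by simp
next
  case (insert i I)
  show ?case
  \<comment> \<open>The ranking induction does not guarantee that \<open>i\<close> is new.\<close>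
  proof (cases "i \<in> I")
    case True
    then show ?thesis using insert by (simp add: insert_absorb)
  next
    case False
    define V where "V = (\<lambda>y. y i) ` S"
    define F where "F v = {x \<in> S. x i = v}" for v
    have fV: "finite V" using insert.prems by (simp add: V_def)
    have fF: "finite (F v)" for v using insert.prems by (simp add: F_def)
    have top: "possible_values (insert i I) w S x i = V" for x
      using insert.hyps(2) by (auto simp: possible_values_def V_def leD)
    have IH: "(\<Sum>x\<in>F v. \<Prod>j\<in>I. 1 / real (card (possible_values I w (F v) x j))) \<le> 1" for v
    proof (rule insert.IH[OF fF])
      fix x y assume "x \<in> F v" "y \<in> F v" "\<forall>i\<in>I. x i = y i"
      then show "x = y" using insert.prems(2)[of x y] by (auto simp: F_def)
    qed
    \<comment> \<open>All of \<open>F v\<close> agrees with \<open>x\<close> at \<open>i\<close>, so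
      restricting to the fibre only removes values. Some may really be lost when
      \<open>w j = w i\<close>, since \<open>S\<close> leaves row \<open>i\<close> free
      there.\<close>
    have mono: "1 / real (card (possible_values (insert i I) w S x j))
        \<le> 1 / real (card (possible_values I w (F v) x j))" if "x \<in> F v" for x v j
    proof -
      have "possible_values I w (F v) x j \<subseteq> possible_values (insert i I) w S x j"
        using that by (auto simp: possible_values_def F_def)
      then have "card (possible_values I w (F v) x j) \<le> card (possible_values (insert i I) w S x j)"
        using insert.prems(1) by (intro card_mono finite_possible_values)
      then show ?thesis
        using card_possible_values_pos[OF fF that, of I w j] by (simp add: frac_le)
    qed
    have "(\<Sum>x\<in>S. \<Prod>j\<in>insert i I. 1 / real (card (possible_values (insert i I) w S x j)))
        = (\<Sum>v\<in>V. \<Sum>x\<in>F v. \<Prod>j\<in>insert i I. 1 / real (card (possible_values (insert i I) w S x j)))"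
      unfolding F_def using insert.prems(1) fV by (subst sum.group) (auto simp: V_def)
    also have "\<dots> \<le> (\<Sum>v\<in>V. 1 / real (card V))"
    proof (rule sum_mono)
      fix v assume "v \<in> V"
      have "(\<Sum>x\<in>F v. \<Prod>j\<in>insert i I. 1 / real (card (possible_values (insert i I) w S x j)))
          = (\<Sum>x\<in>F v. 1 / real (card V) * (\<Prod>j\<in>I. 1 / real (card (possible_values (insert i I) w S x j))))"
        using insert.hyps(1) False by (simp add: top)
      also have "\<dots> \<le> (\<Sum>x\<in>F v. 1 / real (card V) * (\<Prod>j\<in>I. 1 / real (card (possible_values I w (F v) x j))))"
        by (intro sum_mono mult_left_mono prod_mono conjI mono) auto
      also have "\<dots> \<le> 1 / real (card V)"
        using IH[of v] unfolding sum_distrib_left[symmetric]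
        by (intro mult_left_le) auto
      finally show "(\<Sum>x\<in>F v. \<Prod>j\<in>insert i I. 1 / real (card (possible_values (insert i I) w S x j)))
          \<le> 1 / real (card V)" .
    qed
    \<comment> \<open>The sum is 0 if \<open>V\<close> is empty and 1 otherwise.\<close>
    also have "\<dots> \<le> 1" by simp
    finally show ?thesis .
  qed
qed

text \<open>Jensen for the logarithm: with \<open>m\<close> the mean, the tangent bounds
  \<open>ln y \<le> y - 1\<close> at \<open>y = f x / m\<close> have right-hand sides summing to
  0.\<close>

lemma sum_ln_le_ln_average:
  fixes f :: "'a \<Rightarrow> real"
  assumes "finite S" "S \<noteq> {}" "\<And>x. x \<in> S \<Longrightarrow> 0 < f x"
  shows "(\<Sum>x\<in>S. ln (f x)) \<le> real (card S) * ln ((\<Sum>x\<in>S. f x) / real (card S))"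
proof -
  define m where "m = (\<Sum>x\<in>S. f x) / real (card S)"
  have c: "0 < real (card S)" using assms by (simp add: card_gt_0_iff)
  have m: "0 < m" unfolding m_def using assms c by (intro divide_pos_pos sum_pos) auto
  have "(\<Sum>x\<in>S. ln (f x) - ln m) \<le> (\<Sum>x\<in>S. f x / m - 1)"
  proof (rule sum_mono)
    fix x assume "x \<in> S"
    then show "ln (f x) - ln m \<le> f x / m - 1"
      using ln_le_minus_one[of "f x / m"] assms(3)[of x] m by (simp add: ln_div)
  qed
  also have "\<dots> = (\<Sum>x\<in>S. f x) / m - real (card S)"
    by (simp add: sum_subtractf sum_divide_distrib)
  also have "\<dots> = 0" using c m by (simp add: m_def field_simps)
  finally show ?thesis by (simp add: sum_subtractf m_def)
qed

text \<open>Jensen applied to the products \<open>p x\<close>: their sum is at most 1, so their mean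
  is at most \<open>1 / card S\<close>.\<close>

lemma card_ln_card_le_sum_ln_possible_values:
  fixes w :: "'i \<Rightarrow> 'w::linorder"
  assumes "finite I" "finite S" "S \<noteq> {}"
    and "\<And>x y. \<lbrakk>x \<in> S; y \<in> S; \<forall>i\<in>I. x i = y i\<rbrakk> \<Longrightarrow> x = y"
  shows "real (card S) * ln (real (card S))
    \<le> (\<Sum>x\<in>S. \<Sum>i\<in>I. ln (real (card (possible_values I w S x i))))"
proof -
  define p where "p x = (\<Prod>i\<in>I. 1 / real (card (possible_values I w S x i)))" for x
  have N: "0 < real (card (possible_values I w S x i))" if "x \<in> S" for x i
    using card_possible_values_pos[OF assms(2) that] by simp
  have p: "0 < p x" if "x \<in> S" for x
    unfolding p_def using N[OF that] by (intro prod_pos) auto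
  have c: "0 < real (card S)" using assms by (simp add: card_gt_0_iff)
  have sp: "0 < sum p S" using assms p by (intro sum_pos) auto
  have "sum p S \<le> 1"
    unfolding p_def by (rule sum_prod_possible_values_le_1[OF assms(1,2,4)])
  then have "ln (sum p S / real (card S)) \<le> - ln (real (card S))"
    using sp c by (simp add: ln_div)
  then have "(\<Sum>x\<in>S. ln (p x)) \<le> real (card S) * - ln (real (card S))"
    using sum_ln_le_ln_average[OF assms(2,3) p] c by (meson mult_left_mono order_trans less_imp_le)
  moreover have "ln (p x) = - (\<Sum>i\<in>I. ln (real (card (possible_values I w S x i))))" if "x \<in> S" for x
    unfolding p_def using N[OF that] assms(1)
    by (subst ln_prod) (auto simp: ln_div sum_negf)
  ultimately show ?thesis by (simp add: sum_negf)
qed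

section \<open>Averaging over the weights\<close>

text \<open>\<open>T k\<close> stands for the rows able to exclude symbol \<open>k\<close>. Given
  \<open>w i = t\<close>, the other weights are independent and uniform, so those on
  \<open>T k\<close> are all at most \<open>t\<close> with probability
  \<open>(t / M) ^ card (T k)\<close>. Jensen on each slice \<open>W t\<close> uses only
  expectations, so the sets \<open>T k\<close> may overlap.\<close>

lemma sum_ln_unblocked_le:
  fixes T :: "'k \<Rightarrow> 'i set"
  assumes "finite I" "i \<in> I" "0 < M" "finite K" "\<And>k. k \<in> K \<Longrightarrow> T k \<subseteq> I - {i}"
  shows "(\<Sum>w\<in>I \<rightarrow>\<^sub>E {1..M}. ln (1 + (\<Sum>k\<in>K. of_bool (\<forall>s\<in>T k. w s \<le> w i) :: real)))
    \<le> real M ^ (card I - 1) * (\<Sum>t\<in>{1..M}. ln (1 + (\<Sum>k\<in>K. (real t / real M) ^ card (T k))))"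
proof -
  define W where "W t = {w \<in> I \<rightarrow>\<^sub>E {1..M}. w i = t}" for t
  define f where "f w = 1 + (\<Sum>k\<in>K. of_bool (\<forall>s\<in>T k. w s \<le> w i) :: real)" for w :: "'i \<Rightarrow> nat"
  have fin: "finite (I \<rightarrow>\<^sub>E {1..M})" using assms by (intro finite_PiE) auto
  have fW: "finite (W t)" for t using fin by (simp add: W_def)
  have f_pos: "0 < f w" for w unfolding f_def by (intro add_pos_nonneg sum_nonneg) auto
  have card_blocked: "card {w \<in> W t. \<forall>s\<in>B. w s \<le> t} = t ^ card B * M ^ (card I - 1 - card B)"
    if t: "t \<in> {1..M}" and B: "B \<subseteq> I - {i}" for t B
  proof -
    have fB: "finite B" using B assms(1) finite_subset by fast
    \<comment> \<open>The conditions are coordinatewise, so the set is a product: one choice at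
      \<open>i\<close>, \<open>t\<close> choices on \<open>B\<close>, \<open>M\<close>
      elsewhere.\<close>
    have "{w \<in> W t. \<forall>s\<in>B. w s \<le> t}
        = PiE I (\<lambda>s. if s = i then {t} else if s \<in> B then {1..t} else {1..M})"
      (is "_ = PiE I ?X")
    proof (intro equalityI subsetI)
      fix w assume "w \<in> {w \<in> W t. \<forall>s\<in>B. w s \<le> t}"
      then show "w \<in> PiE I ?X" using t by (auto simp: W_def PiE_iff)
    next
      fix w assume w: "w \<in> PiE I ?X"
      have *: "w s \<in> ?X s" if "s \<in> I" for s using w that by (rule PiE_mem)
      have "w s \<in> {1..M}" if "s \<in> I" for s
        using *[OF that] t by (auto split: if_splits)
      moreover have "w i = t" using *[OF assms(2)] by simp
      moreover have "w s \<le> t" if "s \<in> B" for s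
      proof -
        have "s \<in> I" "s \<noteq> i" using that B by auto
        then show ?thesis using *[of s] that by simp
      qed
      ultimately show "w \<in> {w \<in> W t. \<forall>s\<in>B. w s \<le> t}"
        using w by (auto simp: W_def PiE_iff)
    qed
    then have "card {w \<in> W t. \<forall>s\<in>B. w s \<le> t} = (\<Prod>s\<in>I. card (?X s))"
      using assms(1) by (simp add: card_PiE)
    also have "\<dots> = (\<Prod>s\<in>I - {i}. card (?X s))"
      using assms(1,2) by (subst prod.remove[of I i]) auto
    also have "\<dots> = (\<Prod>s\<in>I - {i}. if s \<in> B then t else M)"
      by (intro prod.cong) auto
    also have "\<dots> = t ^ card B * M ^ card (I - {i} - B)"
      using assms(1) B by (subst prod.If_cases) (auto simp: Int_absorb1 Diff_eq)
    also have "card (I - {i} - B) = card I - 1 - card B"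
      using B assms(1,2) fB by (simp add: card_Diff_subset)
    finally show ?thesis .
  qed
  have card_W: "card (W t) = M ^ (card I - 1)" if "t \<in> {1..M}" for t
    using card_blocked[OF that, of "{}"] by simp
  have avg: "(\<Sum>w\<in>W t. f w) / real (card (W t)) = 1 + (\<Sum>k\<in>K. (real t / real M) ^ card (T k))"
    if t: "t \<in> {1..M}" for t
  proof -
    have "(\<Sum>w\<in>W t. f w)
        = real (card (W t)) + (\<Sum>k\<in>K. \<Sum>w\<in>W t. of_bool (\<forall>s\<in>T k. w s \<le> w i))"
      unfolding f_def by (simp add: sum.distrib sum.swap[of _ K])
    also have "(\<Sum>k\<in>K. \<Sum>w\<in>W t. of_bool (\<forall>s\<in>T k. w s \<le> w i) :: real)
        = (\<Sum>k\<in>K. real (card (W t)) * (real t / real M) ^ card (T k))"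
    proof (rule sum.cong[OF refl])
      fix k assume k: "k \<in> K"
      \<comment> \<open>Makes the natural-number subtraction in the exponent of \<open>M\<close>
        exact.\<close>
      have "card (T k) \<le> card (I - {i})"
        using assms(1) assms(5)[OF k] by (intro card_mono) auto
      then have le: "card (T k) \<le> card I - 1" using assms(1,2) by simp
      have "(\<Sum>w\<in>W t. of_bool (\<forall>s\<in>T k. w s \<le> w i) :: real)
          = (\<Sum>w\<in>W t. of_bool (\<forall>s\<in>T k. w s \<le> t))"
        by (intro sum.cong) (auto simp: W_def)
      also have "\<dots> = real (card {w \<in> W t. \<forall>s\<in>T k. w s \<le> t})"
        using fW[of t] by (simp add: sum.inter_filter[symmetric] of_bool_def)
      also have "\<dots> = real t ^ card (T k) * real M ^ (card I - 1 - card (T k))"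
        using card_blocked[OF t assms(5)[OF k]] by simp
      also have "\<dots> = real (card (W t)) * (real t / real M) ^ card (T k)"
        unfolding card_W[OF t] of_nat_power power_divide
        using assms(3) by (subst power_diff[OF _ le]) auto
      finally show "(\<Sum>w\<in>W t. of_bool (\<forall>s\<in>T k. w s \<le> w i) :: real)
        = real (card (W t)) * (real t / real M) ^ card (T k)" .
    qed
    also have "real (card (W t)) + \<dots>
        = real (card (W t)) * (1 + (\<Sum>k\<in>K. (real t / real M) ^ card (T k)))"
      by (simp add: distrib_left sum_distrib_left)
    finally show ?thesis using card_W[OF t] assms(3) by simp
  qed
  have "(\<Sum>w\<in>I \<rightarrow>\<^sub>E {1..M}. ln (f w)) = (\<Sum>t\<in>{1..M}. \<Sum>w\<in>W t. ln (f w))"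
    unfolding W_def using fin assms(2) by (subst sum.group) auto
  also have "\<dots> \<le> (\<Sum>t\<in>{1..M}. real M ^ (card I - 1) *
      ln (1 + (\<Sum>k\<in>K. (real t / real M) ^ card (T k))))"
  proof (rule sum_mono)
    fix t assume t: "t \<in> {1..M}"
    have "W t \<noteq> {}" using card_W[OF t] assms(3) by auto
    then show "(\<Sum>w\<in>W t. ln (f w))
        \<le> real M ^ (card I - 1) * ln (1 + (\<Sum>k\<in>K. (real t / real M) ^ card (T k)))"
      using sum_ln_le_ln_average[of "W t" f, OF fW _ f_pos] card_W[OF t] avg[OF t] by simp
  qed
  finally show ?thesis by (simp add: f_def sum_distrib_left)
qed

text \<open>For increasing \<open>f\<close> the left Riemann sum lies below the integral, cell by
  cell; the right sum exceeds the left one by the telescoping term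
  \<open>(f 1 - f 0) / M\<close>.\<close>

lemma right_Riemann_sum_le:
  fixes f :: "real \<Rightarrow> real"
  assumes "0 < M" "continuous_on {0..1} f" "mono_on {0..1} f"
  shows "(\<Sum>t\<in>{1..M}. f (real t / real M)) / real M \<le> integral {0..1} f + (f 1 - f 0) / real M"
proof -
  have part: "(\<Sum>t<m. f (real t / real M)) / real M \<le> integral {0..real m / real M} f" if "m \<le> M" for m
    using that
  proof (induction m)
    case 0
    then show ?case by simp
  next
    case (Suc m)
    let ?a = "real m / real M" and ?b = "real (Suc m) / real M"
    have ab: "0 \<le> ?a" "?a \<le> ?b" "?b \<le> 1" using Suc.prems assms(1) by (auto simp: field_simps)
    have int: "f integrable_on {c..e}" if "0 \<le> c" "e \<le> 1" for c e
      using that assms(2) by (intro integrable_continuous_real) (auto intro: continuous_on_subset)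
    have "f ?a / real M = integral {?a..?b} (\<lambda>_. f ?a)"
      using ab(2) by (simp add: diff_divide_distrib[symmetric])
    also have "\<dots> \<le> integral {?a..?b} f"
      using ab int[of ?a ?b] assms(3)
      by (intro integral_le) (auto intro!: mono_onD[OF assms(3)] intro: order_trans[OF ab(1)])
    finally have "f ?a / real M \<le> integral {?a..?b} f" .
    moreover have "integral {0..?a} f + integral {?a..?b} f = integral {0..?b} f"
      using ab int[of 0 ?b] by (intro Henstock_Kurzweil_Integration.integral_combine) auto
    ultimately show ?case using Suc by (simp add: add_divide_distrib)
  qed
  have "(\<Sum>t\<in>{1..M}. f (real t / real M)) = (\<Sum>t<M. f (real (Suc t) / real M))"
    by (simp add: sum.atLeast1_atMost_eq)
  also have "\<dots> = (\<Sum>t<M. f (real t / real M)) + (f 1 - f 0)"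
    using sum_lessThan_telescope[of "\<lambda>t. f (real t / real M)" M] assms(1)
    by (simp add: sum_subtractf)
  finally show ?thesis using part[of M] assms(1) by (simp add: add_divide_distrib)
qed

section \<open>Nearly orthogonal arrays\<close>

lemma orthogonal_columns_unique:
  assumes "orthogonal_columns n x y" "l \<in> {1..n\<^sup>2}" "m \<in> {1..n\<^sup>2}"
    and "x l \<in> {1..n}" "y l \<in> {1..n}" "x l = x m" "y l = y m"
  shows "l = m"
  using assms unfolding orthogonal_columns_def by metis

text \<open>Quotient and remainder by \<open>n\<close> determine \<open>l - 1\<close>, and
  \<open>l \<ge> 1\<close> rules out truncation.\<close>

lemma v1_v2_inj: "v1 n l = v1 n m \<Longrightarrow> v2 n l = v2 n m \<Longrightarrow> l \<in> {1..n\<^sup>2} \<Longrightarrow> m \<in> {1..n\<^sup>2} \<Longrightarrow> l = m"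
  unfolding v1_def v2_def
  by (metis Suc_eq_plus1 Suc_inject atLeastAtMost_iff div_mult_mod_eq le_add_diff_inverse2)

lemma is_NOA_entry: "is_NOA n d A \<Longrightarrow> l \<in> {1..n\<^sup>2} \<Longrightarrow> i \<in> {1..d} \<Longrightarrow> A l i \<in> {1..n}"
  by (simp add: is_NOA_def)

text \<open>A column of index at least 4 is orthogonal to every other one; otherwise only the pair
  of columns 1 and 2 is left, handled by \<open>v1\<close> and \<open>v2\<close>.\<close>

lemma is_NOA_two_entries_inj:
  assumes A: "is_NOA n d A" and l: "l \<in> {1..n\<^sup>2}" "m \<in> {1..n\<^sup>2}"
    and ij: "i \<in> {1..d}" "j \<in> {1..d}" "i \<noteq> j" "{i, j} \<noteq> {1, 3}" "{i, j} \<noteq> {2, 3}"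
    and eq: "A l i = A m i" "A l j = A m j"
  shows "l = m"
proof -
  have *: "l = m" if "a \<in> {4..d}" "b \<in> {1..d}" "b \<noteq> a" "A l a = A m a" "A l b = A m b" for a b
  proof (rule orthogonal_columns_unique[OF _ l])
    show "orthogonal_columns n (\<lambda>l. A l a) (\<lambda>l. A l b)"
      using A that unfolding is_NOA_def by blast
  qed (use that is_NOA_entry[OF A l(1), of a] is_NOA_entry[OF A l(1), of b] in auto)
  consider "i \<ge> 4" | "j \<ge> 4" | "i \<le> 3" "j \<le> 3" by linarith
  then show ?thesis
  proof cases
    case 3
    then have "i \<in> {1, 2, 3}" "j \<in> {1, 2, 3}" using ij by auto
    then have "{i, j} = {1, 2}" using ij by auto
    then have "A l 1 = A m 1" "A l 2 = A m 2" using eq by (auto simp: doubleton_eq_iff)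
    then have "v1 n l = v1 n m" "v2 n l = v2 n m" using A l by (auto simp: is_NOA_def)
    then show ?thesis using v1_v2_inj l by blast
  qed (use *[of i j] *[of j i] ij eq in auto)
qed

text \<open>Since \<open>3 \<le> d\<close>, the new column has index at least 4, so condition (c)
  applies to it.\<close>

lemma NOA_extensions_orthogonal:
  assumes "3 \<le> d" "x \<in> NOA_extensions n d A" "j \<in> {1..d}"
  shows "orthogonal_columns n x (\<lambda>l. A l j)"
proof -
  have "is_NOA n (d + 1) (append_column d A x)"
    using assms by (simp add: NOA_extensions_def)
  then have "orthogonal_columns n (\<lambda>l. append_column d A x l (d + 1)) (\<lambda>l. append_column d A x l j)"
    using assms(1,3) unfolding is_NOA_def by auto
  then show ?thesis using assms(3) by (simp add: append_column_def)
qed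

lemma NOA_extensions_entry:
  "x \<in> NOA_extensions n d A \<Longrightarrow> l \<in> {1..n\<^sup>2} \<Longrightarrow> x l \<in> {1..n}"
  by (auto simp: NOA_extensions_def)

section \<open>Rows that block a symbol\<close>

text \<open>Once such a row \<open>s\<close> is revealed, symbol \<open>k\<close> cannot occur at
  \<open>l\<close>: the pair formed by \<open>k\<close> and \<open>A l j\<close> would appear in two
  rows.\<close>

definition blocking_rows ::
    "nat \<Rightarrow> nat \<Rightarrow> (nat \<Rightarrow> nat \<Rightarrow> nat) \<Rightarrow> (nat \<Rightarrow> nat) \<Rightarrow> nat \<Rightarrow> nat \<Rightarrow> nat set" where
  "blocking_rows n d A x l k = {s \<in> {1..n\<^sup>2}. x s = k \<and> (\<exists>j\<in>{1..d}. A s j = A l j)}"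

text \<open>For symbols other than that of row \<open>l\<close>, these rows account for every
  coincidence among the blocking rows that the different columns supply.\<close>

definition doubly_meeting_rows :: "nat \<Rightarrow> (nat \<Rightarrow> nat \<Rightarrow> nat) \<Rightarrow> nat \<Rightarrow> nat set" where
  "doubly_meeting_rows n A l =
     {s \<in> {1..n\<^sup>2}. s \<noteq> l \<and> (A s 1 = A l 1 \<or> A s 2 = A l 2) \<and> A s 3 = A l 3}"

text \<open>The two counted sets are disjoint, since a row agreeing with \<open>l\<close> in columns
  1 and 2 is \<open>l\<close> itself.\<close>

lemma card_doubly_meeting_rows:
  assumes "is_NOA n d A" "l \<in> {1..n\<^sup>2}"
  shows "card (doubly_meeting_rows n A l) = r_count n A l + c_count n A l"
proof -
  have d: "3 \<le> d" using assms(1) by (simp add: is_NOA_def)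
  let ?R = "{s \<in> {1..n\<^sup>2}. s \<noteq> l \<and> A s 1 = A l 1 \<and> A s 3 = A l 3}"
  let ?C = "{s \<in> {1..n\<^sup>2}. s \<noteq> l \<and> A s 2 = A l 2 \<and> A s 3 = A l 3}"
  have "doubly_meeting_rows n A l = ?R \<union> ?C" by (auto simp: doubly_meeting_rows_def)
  moreover have "?R \<inter> ?C = {}"
    using is_NOA_two_entries_inj[OF assms(1) _ assms(2), of _ 1 2] d by (auto simp: doubleton_eq_iff)
  moreover have "finite ?R" "finite ?C" by auto
  ultimately show ?thesis
    unfolding r_count_def c_count_def by (simp only: card_Un_disjoint)
qed

context
  fixes n d :: nat and A :: "nat \<Rightarrow> nat \<Rightarrow> nat" and x :: "nat \<Rightarrow> nat" and l :: nat
  assumes d: "3 \<le> d" and A: "is_NOA n d A" and x: "x \<in> NOA_extensions n d A" and l: "l \<in> {1..n\<^sup>2}"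
begin

lemma extension_column_inj:
  assumes "s \<in> {1..n\<^sup>2}" "s' \<in> {1..n\<^sup>2}" "j \<in> {1..d}" "x s = x s'" "A s j = A s' j"
  shows "s = s'"
  using orthogonal_columns_unique[OF NOA_extensions_orthogonal[OF d x assms(3)] assms(1,2)]
    NOA_extensions_entry[OF x] is_NOA_entry[OF A] assms by blast

text \<open>All these rows share the third entry of row \<open>l\<close>, and \<open>x\<close> is
  orthogonal to column 3, so their symbols differ from each other and from
  \<open>x l\<close>.\<close>

lemma
  shows card_repeated_symbols:
      "card (x ` doubly_meeting_rows n A l) = r_count n A l + c_count n A l"
    and repeated_symbols_subset: "x ` doubly_meeting_rows n A l \<subseteq> {1..n} - {x l}"
proof -
  have "inj_on x (doubly_meeting_rows n A l)"
    using extension_column_inj[of _ _ 3] d by (auto simp: inj_on_def doubly_meeting_rows_def)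
  then show "card (x ` doubly_meeting_rows n A l) = r_count n A l + c_count n A l"
    using card_doubly_meeting_rows[OF A l] by (simp add: card_image)
  show "x ` doubly_meeting_rows n A l \<subseteq> {1..n} - {x l}"
    using extension_column_inj[of _ l 3] NOA_extensions_entry[OF x] d l
    by (force simp: doubly_meeting_rows_def)
qed

lemma blocking_rows_subset:
  "k \<noteq> x l \<Longrightarrow> blocking_rows n d A x l k \<subseteq> {1..n\<^sup>2} - {l}"
  by (auto simp: blocking_rows_def)

text \<open>Each column \<open>j\<close> supplies a blocking row \<sigma> j by orthogonality.
  Dropping column 3 always leaves distinct rows; if \<open>k\<close> is not repeated, column 3 adds
  another.\<close>

lemma card_blocking_rows_ge:
  assumes k: "k \<in> {1..n}" "k \<noteq> x l"
  shows "(if k \<in> x ` doubly_meeting_rows n A l then d - 1 else d) \<le> card (blocking_rows n d A x l k)"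
proof -
  have "\<exists>s\<in>{1..n\<^sup>2}. x s = k \<and> A s j = A l j" if "j \<in> {1..d}" for j
    using NOA_extensions_orthogonal[OF d x that] is_NOA_entry[OF A l that] k(1)
    unfolding orthogonal_columns_def by blast
  then obtain \<sigma> where \<sigma>: "\<And>j. j \<in> {1..d} \<Longrightarrow> \<sigma> j \<in> {1..n\<^sup>2} \<and> x (\<sigma> j) = k \<and> A (\<sigma> j) j = A l j"
    by metis
  have ne: "\<sigma> j \<noteq> l" if "j \<in> {1..d}" for j using \<sigma>[OF that] k(2) by auto
  \<comment> \<open>A common row would agree with row \<open>l\<close> in two columns and hence
    equal \<open>l\<close>, where the symbol is not \<open>k\<close>.\<close>
  have distinct: "\<sigma> i \<noteq> \<sigma> j"
    if "i \<in> {1..d}" "j \<in> {1..d}" "i \<noteq> j" "{i, j} \<noteq> {1, 3}" "{i, j} \<noteq> {2, 3}" for i j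
    using is_NOA_two_entries_inj[OF A _ l that, of "\<sigma> i"] \<sigma>[OF that(1)] \<sigma>[OF that(2)] ne[OF that(1)]
    by metis
  have card_le: "card J \<le> card (blocking_rows n d A x l k)" if "J \<subseteq> {1..d}" "inj_on \<sigma> J" for J
  proof -
    have "\<sigma> ` J \<subseteq> blocking_rows n d A x l k"
      using \<sigma> that(1) unfolding blocking_rows_def by blast
    moreover have "finite (blocking_rows n d A x l k)" by (simp add: blocking_rows_def)
    ultimately show ?thesis using that(2) by (metis card_image card_mono)
  qed
  show ?thesis
  proof (cases "k \<in> x ` doubly_meeting_rows n A l")
    case True
    have "inj_on \<sigma> ({1..d} - {3})"
    proof (rule inj_onI, rule ccontr)
      fix i j assume "i \<in> {1..d} - {3}" "j \<in> {1..d} - {3}" "\<sigma> i = \<sigma> j" "i \<noteq> j"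
      then show False using distinct[of i j] by (auto simp: doubleton_eq_iff)
    qed
    then show ?thesis using card_le[of "{1..d} - {3}"] True d by simp
  next
    case False
    \<comment> \<open>A coincidence with column 3 would give a doubly meeting row carrying
      \<open>k\<close>.\<close>
    have column3: "\<sigma> j \<noteq> \<sigma> 3" if "j \<in> {1, 2}" for j
    proof
      assume eq: "\<sigma> j = \<sigma> 3"
      have "j \<in> {1..d}" "3 \<in> {1..d}" using that d by auto
      then have "\<sigma> j \<in> doubly_meeting_rows n A l" "x (\<sigma> j) = k"
        using \<sigma>[of j] \<sigma>[of 3] ne[of j] eq that by (auto simp: doubly_meeting_rows_def)
      then show False using False by blast
    qed
    have "inj_on \<sigma> {1..d}"
    proof (rule inj_onI, rule ccontr)
      fix i j assume "i \<in> {1..d}" "j \<in> {1..d}" "\<sigma> i = \<sigma> j" "i \<noteq> j"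
      moreover from this have "{i, j} = {1, 3} \<or> {i, j} = {2, 3}" using distinct by blast
      then have "i \<in> {1, 2} \<and> j = 3 \<or> j \<in> {1, 2} \<and> i = 3" by (auto simp: doubleton_eq_iff)
      ultimately show False using column3 by metis
    qed
    then show ?thesis using card_le[of "{1..d}"] False by simp
  qed
qed

text \<open>Powers of \<open>u\<close> decrease in the exponent, so the lower bounds on the numbers
  of blocking rows bound each term from above.\<close>

lemma sum_power_blocking_rows_le:
  fixes u :: real
  assumes u: "0 \<le> u" "u \<le> 1"
  shows "(\<Sum>k\<in>{1..n} - {x l}. u ^ card (blocking_rows n d A x l k))
    \<le> (real (r_count n A l) + real (c_count n A l)) * u ^ (d - 1)
      + (real n - real (r_count n A l) - real (c_count n A l) - 1) * u ^ d"
proof -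
  let ?D = "x ` doubly_meeting_rows n A l" and ?K = "{1..n} - {x l}"
  have n: "1 \<le> n" "x l \<in> {1..n}" using NOA_extensions_entry[OF x l] by auto
  have fD: "finite ?D" by (simp add: doubly_meeting_rows_def)
  have "card ?D \<le> card ?K" by (intro card_mono repeated_symbols_subset) simp
  moreover have "card ?K = n - 1" using n by simp
  ultimately have rest: "real (card (?K - ?D)) = real n - 1 - real (card ?D)"
    using n(1) by (subst card_Diff_subset[OF fD repeated_symbols_subset]) (simp add: of_nat_diff)
  have "(\<Sum>k\<in>?K. u ^ card (blocking_rows n d A x l k)) \<le> (\<Sum>k\<in>?K. if k \<in> ?D then u ^ (d - 1) else u ^ d)"
    using card_blocking_rows_ge u by (intro sum_mono) (fastforce intro: power_decreasing split: if_splits)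
  also have "\<dots> = real (card ?D) * u ^ (d - 1) + real (card (?K - ?D)) * u ^ d"
    using repeated_symbols_subset by (subst sum.If_cases) (auto simp: Int_absorb1 Diff_eq)
  finally show ?thesis unfolding rest card_repeated_symbols by (simp add: algebra_simps)
qed

text \<open>The repeated symbols avoid \<open>x l\<close>. This keeps the coefficient of
  \<open>t ^ d\<close> nonnegative and so makes the integrand monotone.\<close>

lemma r_count_plus_c_count_less: "r_count n A l + c_count n A l + 1 \<le> n"
proof -
  have "card (x ` doubly_meeting_rows n A l) \<le> card ({1..n} - {x l})"
    by (intro card_mono repeated_symbols_subset) simp
  then show ?thesis using card_repeated_symbols NOA_extensions_entry[OF x l] by auto
qed

text \<open>If a heavier row \<open>s\<close> blocks \<open>k\<close>, then any \<open>y\<close>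
  agreeing with \<open>x\<close> at \<open>s\<close> and taking value \<open>k\<close> at
  \<open>l\<close> violates orthogonality with a shared column. The summand 1 counts
  \<open>x l\<close> itself.\<close>

lemma card_possible_values_le:
  fixes w :: "nat \<Rightarrow> 'w::linorder"
  shows "real (card (possible_values {1..n\<^sup>2} w (NOA_extensions n d A) x l))
    \<le> 1 + (\<Sum>k\<in>{1..n} - {x l}. of_bool (\<forall>s\<in>blocking_rows n d A x l k. w s \<le> w l))"
proof -
  let ?U = "{k \<in> {1..n} - {x l}. \<forall>s\<in>blocking_rows n d A x l k. w s \<le> w l}"
  have "possible_values {1..n\<^sup>2} w (NOA_extensions n d A) x l \<subseteq> insert (x l) ?U"
  proof
    fix k assume "k \<in> possible_values {1..n\<^sup>2} w (NOA_extensions n d A) x l"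
    then obtain y where y: "y \<in> NOA_extensions n d A" "k = y l"
        and agree: "\<forall>j\<in>{1..n\<^sup>2}. w l < w j \<longrightarrow> y j = x j"
      by (auto simp: possible_values_def)
    have "w s \<le> w l" if "k \<noteq> x l" and s: "s \<in> blocking_rows n d A x l k" for s
    proof (rule ccontr)
      assume "\<not> w s \<le> w l"
      then have ys: "y s = y l" and "s \<noteq> l" using s agree y(2) by (auto simp: blocking_rows_def)
      obtain j where j: "j \<in> {1..d}" "A s j = A l j" and sI: "s \<in> {1..n\<^sup>2}"
        using s by (auto simp: blocking_rows_def)
      have "s = l"
        using orthogonal_columns_unique[OF NOA_extensions_orthogonal[OF d y(1) j(1)] sI l]
          NOA_extensions_entry[OF y(1) sI] is_NOA_entry[OF A sI j(1)] ys j(2) by simp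
      then show False using \<open>s \<noteq> l\<close> by simp
    qed
    then show "k \<in> insert (x l) ?U" using NOA_extensions_entry[OF y(1) l] y(2) by auto
  qed
  then have "card (possible_values {1..n\<^sup>2} w (NOA_extensions n d A) x l) \<le> card (insert (x l) ?U)"
    by (intro card_mono) auto
  also have "\<dots> \<le> 1 + card ?U" by (simp add: card_insert_if)
  finally have "real (card (possible_values {1..n\<^sup>2} w (NOA_extensions n d A) x l)) \<le> 1 + real (card ?U)"
    by linarith
  also have "real (card ?U) = (\<Sum>k\<in>{1..n} - {x l}. of_bool (\<forall>s\<in>blocking_rows n d A x l k. w s \<le> w l))"
    by (simp add: sum.inter_filter[symmetric] of_bool_def)
  finally show ?thesis .
qed

text \<open>The bound no longer mentions \<open>x\<close>, so summing it over all extensions only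
  contributes their number as a factor.\<close>

lemma sum_ln_possible_values_le:
  assumes M: "0 < M"
  shows "(\<Sum>w\<in>{1..n\<^sup>2} \<rightarrow>\<^sub>E {1..M}.
      ln (real (card (possible_values {1..n\<^sup>2} w (NOA_extensions n d A) x l))))
    \<le> real M ^ (n\<^sup>2 - 1) * (\<Sum>t\<in>{1..M}.
      ln (1 + (real (r_count n A l) + real (c_count n A l)) * (real t / real M) ^ (d - 1)
            + (real n - real (r_count n A l) - real (c_count n A l) - 1) * (real t / real M) ^ d))"
proof -
  have fin: "finite (NOA_extensions n d A)"
    by (rule finite_subset[of _ "{1..n\<^sup>2} \<rightarrow>\<^sub>E {1..n}"]) (auto simp: NOA_extensions_def finite_PiE)
  have "(\<Sum>w\<in>{1..n\<^sup>2} \<rightarrow>\<^sub>E {1..M}.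
        ln (real (card (possible_values {1..n\<^sup>2} w (NOA_extensions n d A) x l))))
      \<le> (\<Sum>w\<in>{1..n\<^sup>2} \<rightarrow>\<^sub>E {1..M}.
        ln (1 + (\<Sum>k\<in>{1..n} - {x l}. of_bool (\<forall>s\<in>blocking_rows n d A x l k. w s \<le> w l))))"
  proof (rule sum_mono)
    fix w :: "nat \<Rightarrow> nat"
    show "ln (real (card (possible_values {1..n\<^sup>2} w (NOA_extensions n d A) x l)))
        \<le> ln (1 + (\<Sum>k\<in>{1..n} - {x l}. of_bool (\<forall>s\<in>blocking_rows n d A x l k. w s \<le> w l)))"
      using card_possible_values_le[of w] card_possible_values_pos[OF fin x, of "{1..n\<^sup>2}" w l]
      by (intro ln_mono) auto
  qed
  also have "\<dots> \<le> real M ^ (n\<^sup>2 - 1) * (\<Sum>t\<in>{1..M}.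
      ln (1 + (\<Sum>k\<in>{1..n} - {x l}. (real t / real M) ^ card (blocking_rows n d A x l k))))"
    using sum_ln_unblocked_le[of "{1..n\<^sup>2}" l M "{1..n} - {x l}" "blocking_rows n d A x l"]
      l M blocking_rows_subset by simp
  also have "\<dots> \<le> real M ^ (n\<^sup>2 - 1) * (\<Sum>t\<in>{1..M}.
      ln (1 + (real (r_count n A l) + real (c_count n A l)) * (real t / real M) ^ (d - 1)
            + (real n - real (r_count n A l) - real (c_count n A l) - 1) * (real t / real M) ^ d))"
  proof (intro mult_left_mono sum_mono)
    fix t assume "t \<in> {1..M}"
    then have "0 \<le> real t / real M" "real t / real M \<le> 1" by auto
    moreover from this(1) have
      "0 < 1 + (\<Sum>k\<in>{1..n} - {x l}. (real t / real M) ^ card (blocking_rows n d A x l k))"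
      by (intro add_pos_nonneg sum_nonneg) auto
    ultimately show
      "ln (1 + (\<Sum>k\<in>{1..n} - {x l}. (real t / real M) ^ card (blocking_rows n d A x l k)))
      \<le> ln (1 + (real (r_count n A l) + real (c_count n A l)) * (real t / real M) ^ (d - 1)
            + (real n - real (r_count n A l) - real (c_count n A l) - 1) * (real t / real M) ^ d)"
      using sum_power_blocking_rows_le[of "real t / real M"] by (intro ln_mono) auto
  qed simp
  finally show ?thesis .
qed

end

section \<open>Passage to the limit and the final bound\<close>

lemma le_of_le_add_divide_nat:
  fixes a b c :: real
  assumes "\<And>m::nat. 0 < m \<Longrightarrow> a \<le> b + c / real m"
  shows "a \<le> b"
proof (rule LIMSEQ_le_const)
  show "(\<lambda>m. b + c / real m) \<longlonglongrightarrow> b"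
    using tendsto_add[OF tendsto_const lim_const_over_n, of b c] by simp
  show "\<exists>N. \<forall>m\<ge>N. a \<le> b + c / real m"
    using assms by (intro exI[of _ 1]) auto
qed

theorem theorem5:
  fixes n d :: nat and A :: "nat \<Rightarrow> nat \<Rightarrow> nat"
  assumes "3 \<le> d"
    and "is_NOA n d A"
    and "card (NOA_extensions n d A) \<noteq> 0"
  shows "ln (real (card (NOA_extensions n d A))) \<le>
    (\<Sum>l\<in>{1..n\<^sup>2}. integral {0..1} (\<lambda>t::real.
       ln (1 + (real (r_count n A l) + real (c_count n A l)) * t ^ (d - 1)
             + (real n - real (r_count n A l) - real (c_count n A l) - 1) * t ^ d)))"
proof -
  let ?I = "{1..n\<^sup>2}" and ?S = "NOA_extensions n d A"
  define f where "f l t = ln (1 + (real (r_count n A l) + real (c_count n A l)) * t ^ (d - 1)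
             + (real n - real (r_count n A l) - real (c_count n A l) - 1) * t ^ d)" for l and t :: real
  \<comment> \<open>Infinite sets have \<open>card\<close> 0, so a nonzero \<open>card\<close>
    yields finiteness too.\<close>
  have fin: "finite ?S" and ne: "?S \<noteq> {}" using assms(3) card_eq_0_iff[of ?S] by auto
  obtain x0 where x0: "x0 \<in> ?S" using ne by blast
  \<comment> \<open>Extensional columns are determined by their values on \<open>?I\<close>.\<close>
  have inj: "x = y" if "x \<in> ?S" "y \<in> ?S" "\<forall>i\<in>?I. x i = y i" for x y
    using that by (intro PiE_ext[of x ?I "\<lambda>_. {1..n}" y]) (auto simp: NOA_extensions_def)
  have Riemann: "(\<Sum>t\<in>{1..M}. f l (real t / real M)) / real M
      \<le> integral {0..1} (f l) + (f l 1 - f l 0) / real M"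
    if l: "l \<in> ?I" and M: "0 < M" for l M
  proof (rule right_Riemann_sum_le[OF M])
    have nonneg: "0 \<le> real n - real (r_count n A l) - real (c_count n A l) - 1"
      using r_count_plus_c_count_less[OF assms(1,2) x0 l] by linarith
    have pos: "0 < 1 + (real (r_count n A l) + real (c_count n A l)) * t ^ (d - 1)
             + (real n - real (r_count n A l) - real (c_count n A l) - 1) * t ^ d"
      if "0 \<le> t" for t :: real
      using that nonneg by (intro add_pos_nonneg mult_nonneg_nonneg zero_le_power) auto
    show "continuous_on {0..1} (f l)"
      unfolding f_def using pos by (intro continuous_intros) force
    show "mono_on {0..1} (f l)"
    proof (rule mono_onI)
      fix s t :: real assume "s \<in> {0..1}" "t \<in> {0..1}" "s \<le> t"
      then show "f l s \<le> f l t"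
        unfolding f_def using pos[of s] nonneg
        by (intro ln_mono add_mono mult_left_mono power_mono) auto
    qed
  qed
  have bound: "ln (real (card ?S)) \<le> (\<Sum>l\<in>?I. integral {0..1} (f l))
      + (\<Sum>l\<in>?I. f l 1 - f l 0) / real M" if M: "0 < M" for M
  proof -
    let ?W = "?I \<rightarrow>\<^sub>E {1..M}"
    have c: "0 < real (card ?S)" using assms(3) by simp
    have card_W: "real (card ?W) = real M ^ n\<^sup>2" by (simp add: card_PiE)
    have "real (card ?S) * (real M ^ n\<^sup>2 * ln (real (card ?S)))
        = (\<Sum>w\<in>?W. real (card ?S) * ln (real (card ?S)))"
      using card_W by simp
    also have "\<dots> \<le> (\<Sum>w\<in>?W. \<Sum>x\<in>?S. \<Sum>l\<in>?I. ln (real (card (possible_values ?I w ?S x l))))"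
      using card_ln_card_le_sum_ln_possible_values[OF finite_atLeastAtMost fin ne inj] by (intro sum_mono)
    also have "\<dots> = (\<Sum>x\<in>?S. \<Sum>l\<in>?I. \<Sum>w\<in>?W. ln (real (card (possible_values ?I w ?S x l))))"
      by (subst sum.swap, rule sum.cong[OF refl], rule sum.swap)
    also have "\<dots> \<le> (\<Sum>x\<in>?S. \<Sum>l\<in>?I. real M ^ (n\<^sup>2 - 1) * (\<Sum>t\<in>{1..M}. f l (real t / real M)))"
      unfolding f_def by (intro sum_mono sum_ln_possible_values_le assms(1,2) M)
    also have "\<dots> = real (card ?S) *
        (real M ^ n\<^sup>2 * (\<Sum>l\<in>?I. (\<Sum>t\<in>{1..M}. f l (real t / real M)) / real M))"
    \<comment> \<open>One factor of \<open>M\<close> normalises the Riemann sum. For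
      \<open>n = 0\<close> the exponent \<open>n\<^sup>2 - 1\<close> is truncated, but there are no
      rows to sum over.\<close>
    proof (cases "n = 0")
      case False
      then have "real M ^ n\<^sup>2 = real M * real M ^ (n\<^sup>2 - 1)"
        by (simp add: power_eq_if)
      then show ?thesis using M
        by (simp add: sum_divide_distrib[symmetric] sum_distrib_left[symmetric])
    qed simp
    finally have "ln (real (card ?S)) \<le> (\<Sum>l\<in>?I. (\<Sum>t\<in>{1..M}. f l (real t / real M)) / real M)"
      using c M by simp
    also have "\<dots> \<le> (\<Sum>l\<in>?I. integral {0..1} (f l) + (f l 1 - f l 0) / real M)"
      by (intro sum_mono Riemann M)
    finally show ?thesis by (simp add: sum.distrib sum_divide_distrib)
  qed
  \<comment> \<open>The error term is a constant divided by \<open>M\<close>, and \<open>M\<close>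
    is arbitrary.\<close>
  then have "ln (real (card ?S)) \<le> (\<Sum>l\<in>?I. integral {0..1} (f l))"
    by (rule le_of_le_add_divide_nat)
  then show ?thesis unfolding f_def[abs_def] .
qed

end
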